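(* Let $m\ge 0$ and let $\sum_{\mathcal{D}} c_{\mathcal{D}}\,\mathcal{D}\in\mathfrak{D}(m)$ be a general trace diagram relation, i.e. a finite $\mathbb{F}$-linear combination of $n$-trace diagrams with $m$ ordered degree-1 vertices for which there is at least one framing of the $m$ degree-1 vertices under which $\sum_{\mathcal{D}} c_{\mathcal{D}} f_{\mathcal{D}}=0$. Then for every framing $\mathfrak{D}(m)\to\mathfrak{D}(I,O)$ (with $I+O=m$), the image of $\sum_{\mathcal{D}} c_{\mathcal{D}}\,\mathcal{D}$ in $\mathfrak{D}(I,O)$ is a framed trace diagram relation, i.e. the trace diagram functions of the framed diagrams satisfy $\sum_{\mathcal{D}} c_{\mathcal{D}} f_{\mathcal{D}}=0$.
   Context: Let $\mathbb{F}$ be a field, $n\ge 2$, $N=\{1,\dots,n\}$, and let $V$ be an $n$-dimensional $\mathbb{F}$-vector space with basis $\hat e_1,\dots,\hat e_n$, orthonormal for the bilinear form $\langle \hat e_i,\hat e_j\rangle=\delta_{ij}$. A linear map $A:V\to V$ has matrix entries $(A)_{ij}=\langle \hat e_i,A\hat e_j\rangle$. For $\alpha\in N^k$ put $\hat e_\alpha=\hat e_{\alpha_1}\otimes\cdots\otimes\hat e_{\alpha_k}$; $V^{\otimes 0}=\mathbb{F}$. Graphs are finite; edges may be repeated, and an edge joins two vertices, or is a loop at one vertex (counted twice in the degree), or is a trivial loop $\bigcirc$ meeting no vertex. An $n$-trace diagram $\mathcal{D}$ is a graph whose vertex set is a disjoint union $V_1\sqcup V_2\sqcup V_n$, vertices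 of $V_i$ having degree $i$ (if $n=2$, $V_2$ and $V_n$ are still kept disjoint), with an ordering $\sigma_v(1),\dots,\sigma_v(\deg v)$ of the edges at each vertex $v$ (a loop is listed twice), and a labeling of each $v\in V_2$ by a linear map $A_{\mathcal{D}}(v):V\to V$. For $v\in V_2$, $\sigma_v(1)$ is the incoming and $\sigma_v(2)$ the outgoing edge. A framing is a partition of $V_1$ into an ordered list of inputs $V_I$ and an ordered list of outputs $V_O$. A coloring is a map $\kappa:E\to N$ on the edge set; it is proper if at each $v\in V_n$ the labels $\kappa(\sigma_v(1)),\dots,\kappa(\sigma_v(n))$ are distinct. For a proper coloring, $\mathrm{sgn}_\kappa(\mathcal{D})=\prod_{v\in V_n}\mathrm{sgn}(i\mapsto\kappa(\sigma_v(i)))$ and $\psi_\kappa(\mathcal{D})=\prod_{v\in V_2}(A_{\mathcal{D}}(v))_{\kappa(\sigma_v(2)),\,\kappa(\sigma_v(1))}$ (empty products are $1$). For a leaf-coloring $\gamma$ (a labeling by $N$ of the edges adjacent to degree-1 vertices), the weight is $\chi_\gamma(\mathcal{D})=\sum_{\kappa}\mathrm{sgn}_\kappa(\mathcal{D})\psi_\kappa(\mathcal{D})$, summed over proper colorings $\kappa$ extending $\gamma$. The trace diagram function of a framed diagram is the linear map $f_{\mathcal{D}}:V^{\otimes |V_I|}\to V^{\otimes|V_O|}$, $\hat e_\alpha\mapsto\sum_{\beta\in N^{|V_O|}}\chi_{\alpha\cup\beta}(\mathcal{D})\,\hat e_\beta$, where $\alpha\cup\beta$ labels the edge at the $j$-th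 input by $\alpha_j$ and the edge at the $j$-th output by $\beta_j$; the weight is $0$ if these labels conflict (an edge joining two degree-1 vertices would receive two different labels). $\mathfrak{D}(m)$ is the free $\mathbb{F}$-module on (unframed) $n$-trace diagrams with $m$ ordered degree-1 vertices, and $\mathfrak{D}(I,O)$ the free $\mathbb{F}$-module on framed $n$-trace diagrams with $I$ inputs and $O$ outputs. A partition of the positions $\{1,\dots,m\}$ into an ordered list of $I$ inputs and an ordered list of $O$ outputs frames all the diagrams at once and gives the linear map $\mathfrak{D}(m)\to\mathfrak{D}(I,O)$, also called a framing. *)

theory Defs
  imports
    Complex_Main
    "HOL-Library.Poly_Mapping"
    "HOL-Library.Multiset"
    "HOL-Library.FuncSet"
    "HOL-Combinatorics.Permutations"
begin

section \<open>The base space\<close>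

locale trace_space = finite_dimensional_vector_space scale "e ` {1..n}"
  for scale :: "'a::field \<Rightarrow> 'v::ab_group_add \<Rightarrow> 'v" and n :: nat and e :: "nat \<Rightarrow> 'v" +
  fixes form :: "'v \<Rightarrow> 'v \<Rightarrow> 'a"
  assumes n_ge_2: "n \<ge> 2"
    and inj_basis: "inj_on e {1..n}"
    and form_linear_left: "\<And>v. Vector_Spaces.linear scale (*) (\<lambda>u. form u v)"
    and form_linear_right: "\<And>u. Vector_Spaces.linear scale (*) (\<lambda>v. form u v)"
    and orthonormal: "\<And>i j. i \<in> {1..n} \<Longrightarrow> j \<in> {1..n} \<Longrightarrow> form (e i) (e j) = (if i = j then 1 else 0)"

definition matrix_entry ::
    "(nat \<Rightarrow> 'v) \<Rightarrow> ('v \<Rightarrow> 'v \<Rightarrow> 'a) \<Rightarrow> ('v \<Rightarrow> 'v) \<Rightarrow> nat \<Rightarrow> nat \<Rightarrow> 'a"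
  where "matrix_entry e form A i j = form (e i) (A (e j))"


section \<open>Free modules and tensor powers\<close>

text \<open>The free module on a type \<open>'k\<close> is \<^typ>\<open>'k \<Rightarrow>\<^sub>0 'a\<close>; the free module on a set of
  basis elements consists of those members whose \<^const>\<open>Poly_Mapping.keys\<close> lie in that set.\<close>

definition fscale :: "'a::field \<Rightarrow> ('k \<Rightarrow>\<^sub>0 'a) \<Rightarrow> ('k \<Rightarrow>\<^sub>0 'a)"
  where "fscale c x = Poly_Mapping.map ((*) c) x"

definition lin_ext :: "('a \<Rightarrow> 'w \<Rightarrow> 'w) \<Rightarrow> ('k \<Rightarrow> 'w) \<Rightarrow> ('k \<Rightarrow>\<^sub>0 'a::field) \<Rightarrow> 'w::ab_group_add"
  where "lin_ext s g x = (\<Sum>k\<in>Poly_Mapping.keys x. s (Poly_Mapping.lookup x k) (g k))"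

lemma lookup_fscale [simp]: "Poly_Mapping.lookup (fscale c x) k = c * Poly_Mapping.lookup x k"
  unfolding fscale_def by transfer (simp add: when_def)

lemma vector_space_fscale: "vector_space fscale"
  by unfold_locales (auto intro!: poly_mapping_eqI simp: lookup_add algebra_simps)

lemma lin_ext_superset:
  assumes "vector_space s" "finite K" "Poly_Mapping.keys x \<subseteq> K"
  shows "lin_ext s g x = (\<Sum>k\<in>K. s (Poly_Mapping.lookup x k) (g k))"
proof -
  interpret vector_space s by fact
  show ?thesis
    unfolding lin_ext_def using assms(2,3)
    by (intro sum.mono_neutral_left) (auto simp: in_keys_iff)
qed

lemma linear_from_rules:
  assumes "vector_space s1" "vector_space s2"
    and "\<And>x y. f (x + y) = f x + f y" "\<And>c x. f (s1 c x) = s2 c (f x)"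
  shows "Vector_Spaces.linear s1 s2 f"
  using assms by (simp add: Vector_Spaces.linear_iff)

lemma linear_lin_ext:
  fixes s :: "'a::field \<Rightarrow> 'w::ab_group_add \<Rightarrow> 'w" and g :: "'k \<Rightarrow> 'w"
  assumes "vector_space s"
  shows "Vector_Spaces.linear fscale s (lin_ext s g)"
proof -
  interpret s: vector_space s by fact
  show ?thesis
  proof (rule linear_from_rules[OF vector_space_fscale assms])
    fix x y :: "'k \<Rightarrow>\<^sub>0 'a"
    let ?K = "Poly_Mapping.keys x \<union> Poly_Mapping.keys y"
    have "Poly_Mapping.keys (x + y) \<subseteq> ?K" by (rule Poly_Mapping.keys_add)
    then show "lin_ext s g (x + y) = lin_ext s g x + lin_ext s g y"
      by (simp add: lin_ext_superset[OF assms, of ?K] lookup_add s.scale_left_distrib sum.distrib)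
  next
    fix c and x :: "'k \<Rightarrow>\<^sub>0 'a"
    have "Poly_Mapping.keys (fscale c x) \<subseteq> Poly_Mapping.keys x" by (auto simp: in_keys_iff)
    then show "lin_ext s g (fscale c x) = s c (lin_ext s g x)"
      by (simp add: lin_ext_superset[OF assms, of "Poly_Mapping.keys x"] s.scale_sum_right)
  qed
qed

lemma lin_ext_single:
  assumes "vector_space s"
  shows "lin_ext s g (Poly_Mapping.single k 1) = g k"
proof -
  interpret vector_space s by fact
  show ?thesis by (simp add: lin_ext_def)
qed

definition multi_indices :: "nat \<Rightarrow> nat \<Rightarrow> nat list set"
  where "multi_indices n k = {\<alpha>. set \<alpha> \<subseteq> {1..n} \<and> length \<alpha> = k}"

text \<open>The \<open>k\<close>-th tensor power of the base space is realized as the free module on the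
  multi-indices of length \<open>k\<close>. The lemmas \<open>multilinear_tensor\<close>, \<open>tensor_universal\<close> and
  \<open>tensor_unique\<close> below show that, with the elementary tensors \<open>tensor n e form vs\<close>, this is a
  tensor power, and \<open>tensor_basis\<close> shows that the basis tensors are the elementary tensors
  of basis vectors.\<close>

definition tensor_power :: "nat \<Rightarrow> nat \<Rightarrow> (nat list \<Rightarrow>\<^sub>0 'a::field) set"
  where "tensor_power n k = {x. Poly_Mapping.keys x \<subseteq> multi_indices n k}"

definition basis_tensor :: "nat list \<Rightarrow> (nat list \<Rightarrow>\<^sub>0 'a::field)"
  where "basis_tensor \<alpha> = Poly_Mapping.single \<alpha> 1"

definition tensor :: "nat \<Rightarrow> (nat \<Rightarrow> 'v) \<Rightarrow> ('v \<Rightarrow> 'v \<Rightarrow> 'a::field) \<Rightarrow> 'v list \<Rightarrow> (nat list \<Rightarrow>\<^sub>0 'a)"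
  where "tensor n e form vs =
    (\<Sum>\<alpha>\<in>multi_indices n (length vs).
      fscale (\<Prod>i<length vs. form (e (\<alpha> ! i)) (vs ! i)) (basis_tensor \<alpha>))"

definition multilinear ::
    "('a::field \<Rightarrow> 'v::ab_group_add \<Rightarrow> 'v) \<Rightarrow> ('a \<Rightarrow> 'w::ab_group_add \<Rightarrow> 'w) \<Rightarrow> nat \<Rightarrow> ('v list \<Rightarrow> 'w) \<Rightarrow> bool"
  where "multilinear s1 s2 k \<phi> \<longleftrightarrow>
    (\<forall>vs i. length vs = k \<longrightarrow> i < k \<longrightarrow> Vector_Spaces.linear s1 s2 (\<lambda>u. \<phi> (vs[i := u])))"


section \<open>Trace diagrams\<close>

text \<open>An edge is incident to two vertices, to one vertex twice (a loop), or to no vertex (a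
  trivial loop); \<open>ends\<close> gives its multiset of endpoints. The incidence of the graph is thus
  explicit and \<open>edge_order D v\<close> lists the edges at \<open>v\<close>, with a loop at \<open>v\<close> occurring twice.\<close>

record ('p, 'e, 'v) trace_diagram =
  verts1 :: "'p set"
  verts2 :: "'p set"
  vertsn :: "'p set"
  edges :: "'e set"
  ends :: "'e \<Rightarrow> 'p multiset"
  edge_order :: "'p \<Rightarrow> 'e list"
  label :: "'p \<Rightarrow> 'v \<Rightarrow> 'v"

definition vertices :: "('p, 'e, 'v) trace_diagram \<Rightarrow> 'p set"
  where "vertices D = verts1 D \<union> verts2 D \<union> vertsn D"

definition degree :: "('p, 'e, 'v) trace_diagram \<Rightarrow> 'p \<Rightarrow> nat"
  where "degree D v = (\<Sum>d\<in>edges D. count (ends D d) v)"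

definition is_trace_diagram ::
    "('a::field \<Rightarrow> 'v::ab_group_add \<Rightarrow> 'v) \<Rightarrow> nat \<Rightarrow> ('p, 'e, 'v) trace_diagram \<Rightarrow> bool"
  where "is_trace_diagram scale n D \<longleftrightarrow>
    finite (vertices D) \<and> finite (edges D) \<and>
    verts1 D \<inter> verts2 D = {} \<and> verts1 D \<inter> vertsn D = {} \<and> verts2 D \<inter> vertsn D = {} \<and>
    (\<forall>d\<in>edges D. set_mset (ends D d) \<subseteq> vertices D \<and> size (ends D d) \<in> {0, 2}) \<and>
    (\<forall>v\<in>verts1 D. degree D v = 1) \<and>
    (\<forall>v\<in>verts2 D. degree D v = 2) \<and>
    (\<forall>v\<in>vertsn D. degree D v = n) \<and>
    (\<forall>v\<in>vertices D. set (edge_order D v) \<subseteq> edges D \<and>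
      (\<forall>d\<in>edges D. count_list (edge_order D v) d = count (ends D d) v)) \<and>
    (\<forall>v\<in>verts2 D. Vector_Spaces.linear scale scale (label D v))"

text \<open>\<open>nth_edge D v i\<close> is the \<open>i\<close>-th edge at \<open>v\<close>, counting from 1.\<close>

definition nth_edge :: "('p, 'e, 'v) trace_diagram \<Rightarrow> 'p \<Rightarrow> nat \<Rightarrow> 'e"
  where "nth_edge D v i = edge_order D v ! (i - 1)"

definition proper_colorings :: "nat \<Rightarrow> ('p, 'e, 'v) trace_diagram \<Rightarrow> ('e \<Rightarrow> nat) set"
  where "proper_colorings n D =
    {\<kappa> \<in> edges D \<rightarrow>\<^sub>E {1..n}. \<forall>v\<in>vertsn D. inj_on (\<lambda>i. \<kappa> (nth_edge D v i)) {1..n}}"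

definition coloring_sign :: "nat \<Rightarrow> ('p, 'e, 'v) trace_diagram \<Rightarrow> ('e \<Rightarrow> nat) \<Rightarrow> int"
  where "coloring_sign n D \<kappa> = (\<Prod>v\<in>vertsn D. sign_on {1..n} (\<lambda>i. \<kappa> (nth_edge D v i)))"

definition coloring_coeff ::
    "(nat \<Rightarrow> 'v) \<Rightarrow> ('v \<Rightarrow> 'v \<Rightarrow> 'a::field) \<Rightarrow> ('p, 'e, 'v) trace_diagram \<Rightarrow> ('e \<Rightarrow> nat) \<Rightarrow> 'a"
  where "coloring_coeff e form D \<kappa> =
    (\<Prod>v\<in>verts2 D. matrix_entry e form (label D v) (\<kappa> (nth_edge D v 2)) (\<kappa> (nth_edge D v 1)))"

text \<open>A leaf labeling is given by its graph, a set of pairs of an edge and a color. If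
  it assigns two colors to one edge, no coloring extends it and its weight is 0.\<close>

definition weight ::
    "nat \<Rightarrow> (nat \<Rightarrow> 'v) \<Rightarrow> ('v \<Rightarrow> 'v \<Rightarrow> 'a::field) \<Rightarrow> ('p, 'e, 'v) trace_diagram \<Rightarrow> ('e \<times> nat) set \<Rightarrow> 'a"
  where "weight n e form D \<gamma> =
    (\<Sum>\<kappa> | \<kappa> \<in> proper_colorings n D \<and> (\<forall>(d, c)\<in>\<gamma>. \<kappa> d = c).
      of_int (coloring_sign n D \<kappa>) * coloring_coeff e form D \<kappa>)"

definition leaf_labels :: "('p, 'e, 'v) trace_diagram \<Rightarrow> 'p list \<Rightarrow> nat list \<Rightarrow> ('e \<times> nat) set"
  where "leaf_labels D vs \<alpha> = set (zip (map (\<lambda>v. nth_edge D v 1) vs) \<alpha>)"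

text \<open>A diagram with ordered degree-1 vertices is paired with the list of these vertices; a
  framed diagram is paired with the lists of inputs and outputs.\<close>

type_synonym ('p, 'e, 'v) ordered_diagram = "('p, 'e, 'v) trace_diagram \<times> 'p list"
type_synonym ('p, 'e, 'v) framed_diagram = "('p, 'e, 'v) trace_diagram \<times> 'p list \<times> 'p list"

definition ordered_diagrams ::
    "('a::field \<Rightarrow> 'v::ab_group_add \<Rightarrow> 'v) \<Rightarrow> nat \<Rightarrow> nat \<Rightarrow> ('p, 'e, 'v) ordered_diagram set"
  where "ordered_diagrams scale n m =
    {(D, vs). is_trace_diagram scale n D \<and> distinct vs \<and> set vs = verts1 D \<and> length vs = m}"

definition framed_diagrams ::
    "('a::field \<Rightarrow> 'v::ab_group_add \<Rightarrow> 'v) \<Rightarrow> nat \<Rightarrow> nat \<Rightarrow> nat \<Rightarrow> ('p, 'e, 'v) framed_diagram set"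
  where "framed_diagrams scale n I O' =
    {(D, ins, outs). is_trace_diagram scale n D \<and> distinct (ins @ outs) \<and>
      set (ins @ outs) = verts1 D \<and> length ins = I \<and> length outs = O'}"

definition trace_function ::
    "nat \<Rightarrow> (nat \<Rightarrow> 'v) \<Rightarrow> ('v \<Rightarrow> 'v \<Rightarrow> 'a::field) \<Rightarrow> ('p, 'e, 'v) framed_diagram \<Rightarrow>
      (nat list \<Rightarrow>\<^sub>0 'a) \<Rightarrow> (nat list \<Rightarrow>\<^sub>0 'a)"
  where "trace_function n e form F =
    (case F of (D, ins, outs) \<Rightarrow>
      lin_ext fscale (\<lambda>\<alpha>. \<Sum>\<beta>\<in>multi_indices n (length outs).
        fscale (weight n e form D (leaf_labels D ins \<alpha> \<union> leaf_labels D outs \<beta>)) (basis_tensor \<beta>)))"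


section \<open>Trace diagram relations\<close>

definition diagram_module ::
    "('a::field \<Rightarrow> 'v::ab_group_add \<Rightarrow> 'v) \<Rightarrow> nat \<Rightarrow> nat \<Rightarrow> (('p, 'e, 'v) ordered_diagram \<Rightarrow>\<^sub>0 'a) set"
  where "diagram_module scale n m = {x. Poly_Mapping.keys x \<subseteq> ordered_diagrams scale n m}"

definition framed_module ::
    "('a::field \<Rightarrow> 'v::ab_group_add \<Rightarrow> 'v) \<Rightarrow> nat \<Rightarrow> nat \<Rightarrow> nat \<Rightarrow> (('p, 'e, 'v) framed_diagram \<Rightarrow>\<^sub>0 'a) set"
  where "framed_module scale n I O' = {y. Poly_Mapping.keys y \<subseteq> framed_diagrams scale n I O'}"

text \<open>A framing of \<open>m\<close> positions consists of the lists of input and of output positions;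
  positions are counted from 0.\<close>

definition is_framing :: "nat \<Rightarrow> nat \<Rightarrow> nat \<Rightarrow> nat list \<times> nat list \<Rightarrow> bool"
  where "is_framing m I O' = (\<lambda>(ps, qs). distinct (ps @ qs) \<and> set (ps @ qs) = {..<m} \<and>
    length ps = I \<and> length qs = O')"

definition frame_diagram ::
    "nat list \<times> nat list \<Rightarrow> ('p, 'e, 'v) ordered_diagram \<Rightarrow> ('p, 'e, 'v) framed_diagram"
  where "frame_diagram = (\<lambda>(ps, qs) (D, vs). (D, map ((!) vs) ps, map ((!) vs) qs))"

definition framing_map ::
    "nat list \<times> nat list \<Rightarrow> (('p, 'e, 'v) ordered_diagram \<Rightarrow>\<^sub>0 'a::field) \<Rightarrow>
      (('p, 'e, 'v) framed_diagram \<Rightarrow>\<^sub>0 'a)"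
  where "framing_map fr = lin_ext fscale (\<lambda>d. Poly_Mapping.single (frame_diagram fr d) 1)"

definition framed_relation ::
    "('a::field \<Rightarrow> 'v::ab_group_add \<Rightarrow> 'v) \<Rightarrow> nat \<Rightarrow> (nat \<Rightarrow> 'v) \<Rightarrow> ('v \<Rightarrow> 'v \<Rightarrow> 'a) \<Rightarrow>
      nat \<Rightarrow> nat \<Rightarrow> (('p, 'e, 'v) framed_diagram \<Rightarrow>\<^sub>0 'a) \<Rightarrow> bool"
  where "framed_relation scale n e form I O' y \<longleftrightarrow>
    y \<in> framed_module scale n I O' \<and>
    (\<forall>x\<in>tensor_power n I. (\<Sum>F\<in>Poly_Mapping.keys y. fscale (Poly_Mapping.lookup y F) (trace_function n e form F x)) = 0)"

definition general_relation ::
    "('a::field \<Rightarrow> 'v::ab_group_add \<Rightarrow> 'v) \<Rightarrow> nat \<Rightarrow> (nat \<Rightarrow> 'v) \<Rightarrow> ('v \<Rightarrow> 'v \<Rightarrow> 'a) \<Rightarrow>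
      nat \<Rightarrow> (('p, 'e, 'v) ordered_diagram \<Rightarrow>\<^sub>0 'a) \<Rightarrow> bool"
  where "general_relation scale n e form m x \<longleftrightarrow>
    x \<in> diagram_module scale n m \<and>
    (\<exists>I O' fr. I + O' = m \<and> is_framing m I O' fr \<and>
      framed_relation scale n e form I O' (framing_map fr x))"


section \<open>Correctness of the encodings\<close>

lemma finite_multi_indices [simp]: "finite (multi_indices n k)"
  unfolding multi_indices_def by (rule finite_lists_length_eq) simp

lemma multi_indices_0: "multi_indices n 0 = {[]}"
  by (auto simp: multi_indices_def)

lemma sum_multi_indices_Suc:
  "(\<Sum>\<alpha>\<in>multi_indices n (Suc k). g \<alpha>) = (\<Sum>j\<in>{1..n}. \<Sum>\<alpha>\<in>multi_indices n k. g (j # \<alpha>))"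
proof -
  have *: "bij_betw (\<lambda>(j, \<alpha>). j # \<alpha>) ({1..n} \<times> multi_indices n k) (multi_indices n (Suc k))"
    by (rule bij_betwI[where g = "\<lambda>\<alpha>. (hd \<alpha>, tl \<alpha>)"])
       (auto simp: multi_indices_def length_Suc_conv)
  show ?thesis
    by (simp add: sum.reindex_bij_betw[OF *, symmetric] sum.cartesian_product split_def)
qed

lemma linear_trace_function: "Vector_Spaces.linear fscale fscale (trace_function n e form F)"
  by (cases F) (simp add: trace_function_def linear_lin_ext vector_space_fscale)

lemma trace_function_basis_tensor:
  "trace_function n e form (D, ins, outs) (basis_tensor \<alpha>) =
    (\<Sum>\<beta>\<in>multi_indices n (length outs).
      fscale (weight n e form D (leaf_labels D ins \<alpha> \<union> leaf_labels D outs \<beta>)) (basis_tensor \<beta>))"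
  unfolding trace_function_def basis_tensor_def by (simp add: lin_ext_single vector_space_fscale)

lemma subspace_tensor_power: "module.subspace fscale (tensor_power n k)"
proof -
  interpret vector_space fscale by (rule vector_space_fscale)
  show ?thesis
    unfolding subspace_def tensor_power_def
    by (auto simp: in_keys_iff lookup_add subset_iff) (metis add.right_neutral)
qed

lemma basis_tensor_in_tensor_power: "\<alpha> \<in> multi_indices n k \<Longrightarrow> basis_tensor \<alpha> \<in> tensor_power n k"
  by (simp add: basis_tensor_def tensor_power_def)

lemma tensor_power_expand:
  assumes "x \<in> tensor_power n k"
  shows "x = (\<Sum>\<alpha>\<in>multi_indices n k. fscale (Poly_Mapping.lookup x \<alpha>) (basis_tensor \<alpha>))"
  using assms
  by (intro poly_mapping_eqI)
     (auto simp: lookup_sum basis_tensor_def lookup_single when_def tensor_power_def in_keys_iff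
       if_distrib cong: if_cong)

lemma trace_function_in_tensor_power:
  "trace_function n e form (D, ins, outs) x \<in> tensor_power n (length outs)"
proof -
  interpret vector_space fscale by (rule vector_space_fscale)
  show ?thesis
    unfolding trace_function_def lin_ext_def
    by (auto intro!: subspace_sum[OF subspace_tensor_power] subspace_scale[OF subspace_tensor_power]
        basis_tensor_in_tensor_power)
qed

lemma weight_conflict:
  assumes "(d, a) \<in> \<gamma>" "(d, b) \<in> \<gamma>" "a \<noteq> b"
  shows "weight n e form D \<gamma> = 0"
proof -
  have "\<not> (\<forall>(d, c)\<in>\<gamma>. \<kappa> d = c)" for \<kappa>
  proof
    assume "\<forall>(d, c)\<in>\<gamma>. \<kappa> d = c"
    from bspec[OF this assms(1)] bspec[OF this assms(2)] show False using assms(3) by simp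
  qed
  then have "{\<kappa>. \<kappa> \<in> proper_colorings n D \<and> (\<forall>(d, c)\<in>\<gamma>. \<kappa> d = c)} = {}" by simp
  then show ?thesis by (simp only: weight_def sum.empty)
qed

context trace_space
begin

lemma basis_expand: "v = (\<Sum>j\<in>{1..n}. scale (form (e j) v) (e j))"
proof -
  interpret p: vector_space_pair scale scale by unfold_locales
  have "Vector_Spaces.linear scale scale (\<lambda>v. \<Sum>j\<in>{1..n}. scale (form (e j) v) (e j))"
  proof (rule p.linear_compose_sum, intro ballI)
    fix j
    have l: "module_hom scale (*) (form (e j))"
      using form_linear_right[of "e j"] by (simp add: Vector_Spaces.linear_iff_module_hom)
    show "Vector_Spaces.linear scale scale (\<lambda>v. scale (form (e j) v) (e j))"
      by (rule linear_from_rules[OF vector_space_axioms vector_space_axioms])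
         (simp_all add: module_hom.add[OF l] module_hom.scale[OF l] scale_left_distrib)
  qed
  then have "id v = (\<Sum>j\<in>{1..n}. scale (form (e j) v) (e j))"
  proof (rule p.linear_eq_on_span[OF linear_id])
    fix x assume "x \<in> e ` {1..n}"
    then obtain i where i: "i \<in> {1..n}" "x = e i" by auto
    have "(\<Sum>j\<in>{1..n}. scale (form (e j) x) (e j)) = (\<Sum>j\<in>{1..n}. if j = i then e j else 0)"
      using i by (intro sum.cong) (auto simp: orthonormal)
    then show "id x = (\<Sum>j\<in>{1..n}. scale (form (e j) x) (e j))"
      using i by simp
  qed (simp only: span_Basis UNIV_I)
  then show ?thesis by simp
qed

lemma tensor_in_tensor_power: "tensor n e form vs \<in> tensor_power n (length vs)"
proof -
  interpret f: vector_space fscale by (rule vector_space_fscale)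
  show ?thesis
    unfolding tensor_def
    by (intro f.subspace_sum[OF subspace_tensor_power] f.subspace_scale[OF subspace_tensor_power]
        basis_tensor_in_tensor_power)
qed

lemma lookup_tensor:
  "Poly_Mapping.lookup (tensor n e form vs) \<alpha> =
    (if \<alpha> \<in> multi_indices n (length vs) then \<Prod>i<length vs. form (e (\<alpha> ! i)) (vs ! i) else 0)"
  by (auto simp: tensor_def lookup_sum basis_tensor_def lookup_single when_def if_distrib cong: if_cong)

lemma tensor_basis:
  assumes "\<alpha> \<in> multi_indices n k"
  shows "tensor n e form (map e \<alpha>) = basis_tensor \<alpha>"
proof (rule poly_mapping_eqI)
  fix \<beta>
  have \<alpha>: "length \<alpha> = k" "\<And>i. i < k \<Longrightarrow> \<alpha> ! i \<in> {1..n}"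
    using assms nth_mem by (fastforce simp: multi_indices_def)+
  show "Poly_Mapping.lookup (tensor n e form (map e \<alpha>)) \<beta> = Poly_Mapping.lookup (basis_tensor \<alpha>) \<beta>"
  proof (cases "\<beta> \<in> multi_indices n k")
    case True
    then have \<beta>: "length \<beta> = k" "\<And>i. i < k \<Longrightarrow> \<beta> ! i \<in> {1..n}"
      using nth_mem by (fastforce simp: multi_indices_def)+
    have "(\<Prod>i<k. form (e (\<beta> ! i)) (e (\<alpha> ! i))) = (\<Prod>i<k. if \<beta> ! i = \<alpha> ! i then 1 else 0)"
      using \<alpha> \<beta> by (intro prod.cong) (auto simp: orthonormal)
    also have "\<dots> = (if \<alpha> = \<beta> then 1 else 0)"
      using \<alpha>(1) \<beta>(1) by (auto simp: list_eq_iff_nth_eq intro!: prod_zero; metis lessThan_iff)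
    finally show ?thesis
      using True \<alpha>(1) by (simp add: lookup_tensor basis_tensor_def lookup_single when_def)
  next
    case False
    then have "\<alpha> \<noteq> \<beta>" using assms by auto
    with False \<alpha>(1) show ?thesis
      by (simp add: lookup_tensor basis_tensor_def lookup_single)
  qed
qed

lemma multilinear_tensor: "multilinear scale fscale k (tensor n e form)"
  unfolding multilinear_def
proof (intro allI impI)
  fix vs :: "'v list" and i assume k: "length vs = k" "i < k"
  have *: "(\<Prod>j<k. form (e (\<alpha> ! j)) (vs[i := u] ! j)) =
      form (e (\<alpha> ! i)) u * (\<Prod>j\<in>{..<k} - {i}. form (e (\<alpha> ! j)) (vs ! j))" for \<alpha> u
    using k by (subst prod.remove[of _ i]) auto
  have l: "module_hom scale (*) (form u)" for u
    using form_linear_right[of u] by (simp add: Vector_Spaces.linear_iff_module_hom)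
  show "Vector_Spaces.linear scale fscale (\<lambda>u. tensor n e form (vs[i := u]))"
    by (rule linear_from_rules[OF vector_space_axioms vector_space_fscale]; rule poly_mapping_eqI)
       (simp_all add: lookup_tensor lookup_add k * module_hom.add[OF l] module_hom.scale[OF l]
         algebra_simps)
qed

lemma multilinear_expand:
  assumes "vector_space s" "multilinear scale s k \<phi>" "length vs = k"
  shows "\<phi> vs = (\<Sum>\<alpha>\<in>multi_indices n k. s (\<Prod>i<k. form (e (\<alpha> ! i)) (vs ! i)) (\<phi> (map e \<alpha>)))"
  using assms(2,3)
proof (induction k arbitrary: vs \<phi>)
  case 0
  interpret s: vector_space s by fact
  show ?case using 0 by (simp add: multi_indices_0)
next
  case (Suc k)
  interpret s: vector_space s by fact
  obtain v ws where vs: "vs = v # ws" "length ws = k"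
    using Suc.prems by (auto simp: length_Suc_conv)
  have l: "module_hom scale s (\<lambda>u. \<phi> (u # ws))"
    using Suc.prems(1)[unfolded multilinear_def, rule_format, of vs 0] vs
    by (simp add: Vector_Spaces.linear_iff_module_hom)
  have IH: "\<phi> (e j # ws) = (\<Sum>\<alpha>\<in>multi_indices n k.
      s (\<Prod>i<k. form (e (\<alpha> ! i)) (ws ! i)) (\<phi> (e j # map e \<alpha>)))" for j
  proof (rule Suc.IH[OF _ vs(2)])
    show "multilinear scale s k (\<lambda>ws. \<phi> (e j # ws))"
      unfolding multilinear_def
    proof (intro allI impI)
      fix ws :: "'v list" and i assume "length ws = k" "i < k"
      then show "Vector_Spaces.linear scale s (\<lambda>u. \<phi> (e j # ws[i := u]))"
        using Suc.prems(1)[unfolded multilinear_def, rule_format, of "e j # ws" "Suc i"] by simp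
    qed
  qed
  have "\<phi> vs = \<phi> ((\<Sum>j\<in>{1..n}. scale (form (e j) v) (e j)) # ws)"
    using vs(1) basis_expand[of v] by simp
  also have "\<dots> = (\<Sum>j\<in>{1..n}. s (form (e j) v) (\<phi> (e j # ws)))"
    by (simp add: module_hom.sum[OF l] module_hom.scale[OF l])
  also have "\<dots> = (\<Sum>j\<in>{1..n}. \<Sum>\<alpha>\<in>multi_indices n k.
      s (\<Prod>i<Suc k. form (e ((j # \<alpha>) ! i)) (vs ! i)) (\<phi> (map e (j # \<alpha>))))"
    by (simp add: IH s.scale_sum_right vs(1) prod.lessThan_Suc_shift del: prod.lessThan_Suc)
  finally show ?case by (simp only: sum_multi_indices_Suc)
qed

lemma tensor_universal:
  assumes "vector_space s" "multilinear scale s k \<phi>"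
  shows "\<exists>g. Vector_Spaces.linear fscale s g \<and> (\<forall>vs. length vs = k \<longrightarrow> g (tensor n e form vs) = \<phi> vs)"
proof (intro exI conjI allI impI)
  let ?g = "lin_ext s (\<lambda>\<alpha>. \<phi> (map e \<alpha>))"
  show "Vector_Spaces.linear fscale s ?g" by (rule linear_lin_ext[OF assms(1)])
  fix vs :: "'v list" assume k: "length vs = k"
  have "Poly_Mapping.keys (tensor n e form vs) \<subseteq> multi_indices n k"
    using tensor_in_tensor_power[of vs] k by (simp add: tensor_power_def)
  then have "?g (tensor n e form vs) =
      (\<Sum>\<alpha>\<in>multi_indices n k. s (Poly_Mapping.lookup (tensor n e form vs) \<alpha>) (\<phi> (map e \<alpha>)))"
    by (intro lin_ext_superset assms) auto
  also have "\<dots> = \<phi> vs"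
    unfolding multilinear_expand[OF assms k] using k by (intro sum.cong) (auto simp: lookup_tensor)
  finally show "?g (tensor n e form vs) = \<phi> vs" .
qed

lemma tensor_unique:
  assumes "Vector_Spaces.linear fscale s g" "Vector_Spaces.linear fscale s h"
    and "\<And>vs. length vs = k \<Longrightarrow> g (tensor n e form vs) = h (tensor n e form vs)"
    and "x \<in> tensor_power n k"
  shows "g x = h x"
proof -
  have lg: "module_hom fscale s g" and lh: "module_hom fscale s h"
    using assms(1,2) by (simp_all add: Vector_Spaces.linear_iff_module_hom)
  have "g (basis_tensor \<alpha>) = h (basis_tensor \<alpha>)" if "\<alpha> \<in> multi_indices n k" for \<alpha>
    using assms(3)[of "map e \<alpha>"] tensor_basis[OF that] that by (simp add: multi_indices_def)
  then show ?thesis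
    by (subst (1 2) tensor_power_expand[OF assms(4)])
       (simp add: module_hom.sum[OF lg] module_hom.sum[OF lh] module_hom.scale[OF lg]
         module_hom.scale[OF lh])
qed

end

end

theory Submission
  imports Defs
begin

text \<open>The function of a framed diagram, expanded in basis tensors, has as coefficients the weights
  of the unframed diagram at the leaf labelings, and a framing only decides which part of a leaf
  labeling indexes the columns and which part the rows. Hence, whatever the framing, the relation
  says that the corresponding combination of weights vanishes at every leaf labeling.\<close>

text \<open>Both sides are linear in \<open>x\<close> and agree on single diagrams; if
  \<open>frame_diagram fr\<close> identifies diagrams, their coefficients add up on either side.
  This turns sums over the keys of the framed combination into sums over the keys of
  \<open>x\<close>.\<close>

lemma lin_ext_framing_map:
  assumes "vector_space s"
  shows "lin_ext s g (framing_map fr x) = lin_ext s (\<lambda>d. g (frame_diagram fr d)) x"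
proof -
  have l: "module_hom fscale s (lin_ext s g)"
    using linear_lin_ext[OF assms] by (simp add: Vector_Spaces.linear_iff_module_hom)
  have "lin_ext s g (framing_map fr x) = (\<Sum>d\<in>Poly_Mapping.keys x.
      s (Poly_Mapping.lookup x d) (lin_ext s g (Poly_Mapping.single (frame_diagram fr d) 1)))"
    unfolding framing_map_def lin_ext_def[of fscale]
    by (simp add: module_hom.sum[OF l] module_hom.scale[OF l])
  then show ?thesis
    by (simp only: lin_ext_single[OF assms] lin_ext_def[of s "\<lambda>d. g (frame_diagram fr d)"])
qed

lemma keys_framing_map: "Poly_Mapping.keys (framing_map fr x) \<subseteq> frame_diagram fr ` Poly_Mapping.keys x"
proof
  fix F assume F: "F \<in> Poly_Mapping.keys (framing_map fr x)"
  show "F \<in> frame_diagram fr ` Poly_Mapping.keys x"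
  proof (rule ccontr)
    assume "F \<notin> frame_diagram fr ` Poly_Mapping.keys x"
    then have "Poly_Mapping.lookup (framing_map fr x) F = 0"
      by (auto simp: framing_map_def lin_ext_def lookup_sum lookup_single when_def intro!: sum.neutral)
    with F show False by (simp add: in_keys_iff)
  qed
qed

lemma frame_diagram_in_framed_diagrams:
  assumes "d \<in> ordered_diagrams scale n m" "is_framing m I O' fr"
  shows "frame_diagram fr d \<in> framed_diagrams scale n I O'"
proof -
  obtain D vs ps qs where d: "d = (D, vs)" and fr: "fr = (ps, qs)" by (cases d, cases fr)
  have D: "is_trace_diagram scale n D" "distinct vs" "set vs = verts1 D" "length vs = m"
    using assms(1) by (auto simp: d ordered_diagrams_def)
  have f: "distinct (ps @ qs)" "set (ps @ qs) = {..<m}" "length ps = I" "length qs = O'"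
    using assms(2) by (auto simp: fr is_framing_def)
  have inj: "inj_on ((!) vs) {..<m}"
    using D by (auto simp: inj_on_def nth_eq_iff_index_eq)
  have "distinct (map ((!) vs) (ps @ qs))"
    using f(1) inj by (simp only: distinct_map f(2))
  moreover have "set (map ((!) vs) (ps @ qs)) = verts1 D"
    using D(3,4) by (simp only: set_map f(2)) (auto simp: set_conv_nth)
  ultimately show ?thesis
    using D f by (simp add: d fr frame_diagram_def framed_diagrams_def)
qed

lemma framing_map_in_framed_module:
  assumes "x \<in> diagram_module scale n m" "is_framing m I O' fr"
  shows "framing_map fr x \<in> framed_module scale n I O'"
  using keys_framing_map[of fr x] frame_diagram_in_framed_diagrams[OF _ assms(2)] assms(1)
  unfolding framed_module_def diagram_module_def by fastforce

text \<open>A leaf labeling is a set of edge-color pairs, so the order of positions is irrelevant,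
  and \<open>ps\<close> and \<open>qs\<close> together run through all of them. Conflicting labels
  on one edge are kept by both sides alike.\<close>

lemma leaf_labels_framing:
  assumes "is_framing m I O' (ps, qs)" "length vs = m" "length \<gamma> = m"
  shows "leaf_labels D (map ((!) vs) ps) (map ((!) \<gamma>) ps) \<union>
      leaf_labels D (map ((!) vs) qs) (map ((!) \<gamma>) qs) = leaf_labels D vs \<gamma>"
proof -
  have map: "leaf_labels D (map ((!) vs) rs) (map ((!) \<gamma>) rs) =
      (\<lambda>p. (nth_edge D (vs ! p) 1, \<gamma> ! p)) ` set rs" for rs
    by (simp add: leaf_labels_def zip_map_map zip_same_conv_map image_image)
  have "leaf_labels D vs \<gamma> = (\<lambda>p. (nth_edge D (vs ! p) 1, \<gamma> ! p)) ` {..<m}"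
    using assms(2,3) unfolding leaf_labels_def set_zip
    by (force simp: image_def)
  moreover have "set ps \<union> set qs = {..<m}"
    using assms(1) by (simp add: is_framing_def)
  ultimately show ?thesis by (simp only: map image_Un[symmetric])
qed

lemma map_nth_multi_indices:
  assumes "\<gamma> \<in> multi_indices n m" "set rs \<subseteq> {..<m}" "length rs = k"
  shows "map ((!) \<gamma>) rs \<in> multi_indices n k"
  using assms by (fastforce simp: multi_indices_def)

text \<open>Converse to restricting a labeling to inputs and outputs: since \<open>ps @ qs\<close>
  lists each position exactly once, a column index and a row index can always be glued
  together.\<close>

lemma framing_split_multi_index:
  assumes "is_framing m I O' (ps, qs)" "\<alpha> \<in> multi_indices n I" "\<beta> \<in> multi_indices n O'"
  obtains \<gamma> where "\<gamma> \<in> multi_indices n m" "map ((!) \<gamma>) ps = \<alpha>" "map ((!) \<gamma>) qs = \<beta>"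
proof -
  have f: "distinct (ps @ qs)" "set (ps @ qs) = {..<m}" "length ps = I" "length qs = O'"
    using assms(1) by (auto simp: is_framing_def)
  have l: "length \<alpha> = I" "length \<beta> = O'" "set (\<alpha> @ \<beta>) \<subseteq> {1..n}"
    using assms(2,3) by (auto simp: multi_indices_def)
  have len: "length (ps @ qs) = length (\<alpha> @ \<beta>)" using f l by simp
  \<comment> \<open>\<open>h p\<close> is the entry of \<open>\<alpha> @ \<beta>\<close> at the
    place where \<open>p\<close> occurs in \<open>ps @ qs\<close>; every \<open>p < m\<close> occurs
    there. The list of these values is the required \<open>\<gamma>\<close>.\<close>
  define h where "h p = the (map_of (zip (ps @ qs) (\<alpha> @ \<beta>)) p)" for p
  have h: "map h (ps @ qs) = \<alpha> @ \<beta>"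
  proof (rule nth_equalityI)
    fix i assume "i < length (map h (ps @ qs))"
    then show "map h (ps @ qs) ! i = (\<alpha> @ \<beta>) ! i"
      unfolding h_def using map_of_zip_nth[OF len f(1)] len by (simp del: map_append append_assoc)
  qed (use len in simp)
  have nth: "map ((!) (map h [0..<m])) rs = map h rs" if "set rs \<subseteq> {..<m}" for rs
    using that by auto
  show thesis
  proof
    have "set (map h [0..<m]) = set (map h (ps @ qs))"
      by (simp only: set_map f(2)) (simp add: atLeast0LessThan)
    then show "map h [0..<m] \<in> multi_indices n m"
      using l(3) unfolding h by (simp add: multi_indices_def del: set_map)
    have "set ps \<subseteq> {..<m}" "set qs \<subseteq> {..<m}" "map h ps = \<alpha>" "map h qs = \<beta>"
      using f h l by auto
    then show "map ((!) (map h [0..<m])) ps = \<alpha>" "map ((!) (map h [0..<m])) qs = \<beta>"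
      by (simp_all only: nth)
  qed
qed

lemma lookup_trace_function:
  "Poly_Mapping.lookup (trace_function n e form (D, ins, outs) t) \<beta> =
    (if \<beta> \<in> multi_indices n (length outs)
     then \<Sum>\<alpha>\<in>Poly_Mapping.keys t. Poly_Mapping.lookup t \<alpha> *
       weight n e form D (leaf_labels D ins \<alpha> \<union> leaf_labels D outs \<beta>) else 0)"
  by (auto simp: trace_function_def lin_ext_def lookup_sum basis_tensor_def lookup_single when_def
      if_distrib cong: if_cong intro!: sum.cong sum.neutral)

text \<open>The right-hand side mentions neither \<open>fr\<close> nor \<open>I\<close> and
  \<open>O'\<close>, so it can be shared by any two framings. It holds because the matrix entries of
  the combined function are exactly the sums \<open>?W \<gamma>\<close>.\<close>

lemma framed_relation_framing_map_iff:
  fixes x :: "('p, 'e, 'v::ab_group_add) ordered_diagram \<Rightarrow>\<^sub>0 'a::field"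
  assumes x: "x \<in> diagram_module scale n m" and fr: "is_framing m I O' fr"
  shows "framed_relation scale n e form I O' (framing_map fr x) \<longleftrightarrow>
    (\<forall>\<gamma>\<in>multi_indices n m. (\<Sum>(D, vs)\<in>Poly_Mapping.keys x.
      Poly_Mapping.lookup x (D, vs) * weight n e form D (leaf_labels D vs \<gamma>)) = 0)"
    (is "_ \<longleftrightarrow> (\<forall>\<gamma>\<in>_. ?W \<gamma> = 0)")
proof -
  obtain ps qs where pq: "fr = (ps, qs)" by (cases fr)
  have f: "set ps \<subseteq> {..<m}" "set qs \<subseteq> {..<m}" "length ps = I" "length qs = O'"
    using fr by (auto simp: pq is_framing_def)
  \<comment> \<open>\<open>S\<close> is the combined trace function of the framed diagrams, summed
    over the unframed ones.\<close>
  define S where "S t = (\<Sum>d\<in>Poly_Mapping.keys x.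
    fscale (Poly_Mapping.lookup x d) (trace_function n e form (frame_diagram fr d) t))" for t
  have rel: "framed_relation scale n e form I O' (framing_map fr x) \<longleftrightarrow> (\<forall>t\<in>tensor_power n I. S t = 0)"
    using framing_map_in_framed_module[OF x fr]
      lin_ext_framing_map[OF vector_space_fscale, of "\<lambda>F. trace_function n e form F _" fr x]
    by (simp add: framed_relation_def S_def lin_ext_def)
  have W: "(\<Sum>(D, vs)\<in>Poly_Mapping.keys x. Poly_Mapping.lookup x (D, vs) *
      weight n e form D (leaf_labels D (map ((!) vs) ps) (map ((!) \<gamma>) ps) \<union>
        leaf_labels D (map ((!) vs) qs) (map ((!) \<gamma>) qs))) = ?W \<gamma>"
    if "\<gamma> \<in> multi_indices n m" for \<gamma>
  proof (rule sum.cong[OF refl])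
    fix d assume d: "d \<in> Poly_Mapping.keys x"
    obtain D vs where Dvs: "d = (D, vs)" by (cases d)
    have "length vs = m" "length \<gamma> = m"
      using d x that by (auto simp: Dvs diagram_module_def ordered_diagrams_def multi_indices_def)
    from leaf_labels_framing[OF fr[unfolded pq] this, of D]
    show "(case d of (D, vs) \<Rightarrow> Poly_Mapping.lookup x (D, vs) *
        weight n e form D (leaf_labels D (map ((!) vs) ps) (map ((!) \<gamma>) ps) \<union>
          leaf_labels D (map ((!) vs) qs) (map ((!) \<gamma>) qs))) =
      (case d of (D, vs) \<Rightarrow> Poly_Mapping.lookup x (D, vs) * weight n e form D (leaf_labels D vs \<gamma>))"
      by (simp add: Dvs)
  qed
  \<comment> \<open>Exchanging the sums over diagrams and over \<open>\<alpha>\<close> exposes, as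
    inner sum, the matrix entry of \<open>S\<close> in row \<open>\<beta>\<close> and column
    \<open>\<alpha>\<close>.\<close>
  have S: "Poly_Mapping.lookup (S t) \<beta> = (if \<beta> \<in> multi_indices n O' then
      \<Sum>\<alpha>\<in>Poly_Mapping.keys t. Poly_Mapping.lookup t \<alpha> *
        (\<Sum>(D, vs)\<in>Poly_Mapping.keys x. Poly_Mapping.lookup x (D, vs) *
          weight n e form D (leaf_labels D (map ((!) vs) ps) \<alpha> \<union> leaf_labels D (map ((!) vs) qs) \<beta>))
      else 0)" for t \<beta>
    by (auto simp: S_def lookup_sum frame_diagram_def pq split_def lookup_trace_function f
        sum_distrib_left mult.left_commute intro: sum.swap)
  show ?thesis
    unfolding rel
  proof (intro iffI ballI)
    fix \<gamma> assume zero: "\<forall>t\<in>tensor_power n I. S t = 0" and \<gamma>: "\<gamma> \<in> multi_indices n m"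
    let ?\<alpha> = "map ((!) \<gamma>) ps" and ?\<beta> = "map ((!) \<gamma>) qs"
    \<comment> \<open>Evaluating at a basis tensor isolates one column; its coefficient in row
      \<open>?\<beta>\<close> is \<open>?W \<gamma>\<close>.\<close>
    have "S (basis_tensor ?\<alpha>) = 0"
      using zero basis_tensor_in_tensor_power map_nth_multi_indices[OF \<gamma> f(1,3)] by blast
    then have "Poly_Mapping.lookup (S (basis_tensor ?\<alpha>)) ?\<beta> = 0" by simp
    then show "?W \<gamma> = 0"
      unfolding S using map_nth_multi_indices[OF \<gamma> f(2,4)]
      by (simp add: basis_tensor_def W[OF \<gamma>])
  next
    fix t :: "nat list \<Rightarrow>\<^sub>0 'a"
    assume zero: "\<forall>\<gamma>\<in>multi_indices n m. ?W \<gamma> = 0" and t: "t \<in> tensor_power n I"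
    show "S t = 0"
    proof (rule poly_mapping_eqI)
      fix \<beta>
      \<comment> \<open>Each matrix entry vanishes, because its row and column indices glue to some
        \<open>\<gamma>\<close> with \<open>?W \<gamma> = 0\<close>. Rows outside
        \<open>multi_indices n O'\<close> are zero by \<open>S\<close> already.\<close>
      have "(\<Sum>(D, vs)\<in>Poly_Mapping.keys x. Poly_Mapping.lookup x (D, vs) *
          weight n e form D (leaf_labels D (map ((!) vs) ps) \<alpha> \<union> leaf_labels D (map ((!) vs) qs) \<beta>)) = 0"
        if \<alpha>: "\<alpha> \<in> Poly_Mapping.keys t" and \<beta>: "\<beta> \<in> multi_indices n O'" for \<alpha>
      proof -
        have "\<alpha> \<in> multi_indices n I" using \<alpha> t by (auto simp: tensor_power_def)
        then obtain \<gamma> where \<gamma>: "\<gamma> \<in> multi_indices n m" "map ((!) \<gamma>) ps = \<alpha>" "map ((!) \<gamma>) qs = \<beta>"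
          using framing_split_multi_index[OF fr[unfolded pq] _ \<beta>] by blast
        show ?thesis using W[OF \<gamma>(1)] zero \<gamma> by simp
      qed
      then show "Poly_Mapping.lookup (S t) \<beta> = Poly_Mapping.lookup 0 \<beta>"
        unfolding S by simp
    qed
  qed
qed

theorem theorem5p5:
  fixes scale :: "'a::field \<Rightarrow> 'v::ab_group_add \<Rightarrow> 'v"
    and n m I O' :: nat
    and e :: "nat \<Rightarrow> 'v"
    and form :: "'v \<Rightarrow> 'v \<Rightarrow> 'a"
    and x :: "('p, 'e, 'v) ordered_diagram \<Rightarrow>\<^sub>0 'a"
    and fr :: "nat list \<times> nat list"
  assumes "trace_space scale n e form"
    and "general_relation scale n e form m x"
    and "I + O' = m"
    and "is_framing m I O' fr"
  shows "framed_relation scale n e form I O' (framing_map fr x)"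
proof -
  obtain J Q fr' where x: "x \<in> diagram_module scale n m" and fr': "is_framing m J Q fr'"
    and rel: "framed_relation scale n e form J Q (framing_map fr' x)"
    using assms(2) by (auto simp: general_relation_def)
  \<comment> \<open>Unfolding the criterion for \<open>fr'\<close> in \<open>rel\<close> and for
    \<open>fr\<close> in the goal leaves the same condition on weights.\<close>
  show ?thesis
    using rel
    unfolding framed_relation_framing_map_iff[OF x fr'] framed_relation_framing_map_iff[OF x assms(4)] .
qed

end
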